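(* Let $k\in(0,1)$, suppose $\alpha\in(0,\tfrac12\pi)$, and let $a=g(\alpha;k)$. If $z_1\in T$ and $z_2=\psi_\alpha(z_1)$, then the directed segment $z_1z_2$ is on the right side of, and tangent to, the positively oriented circle $C_a$. Conversely, if $z_1,z_2\in T$ and the directed segment $z_1z_2$ is on the right side of, and tangent to, the positively oriented circle $C_a$, then $z_2=\psi_\alpha(z_1)$.
   Context: $T$ is the unit circle in $\mathbb C=\mathbb R^2$. Let $g(\theta)=g(\theta;k)=\int_0^\theta \frac{dt}{\sqrt{1-k^2\sin^2 t}}$ for $\theta\in\mathbb R$, $K=g(\pi/2)$, $\mathrm{am}=g^{-1}:\mathbb R\to\mathbb R$, $\mathrm{sn}\,u=\sin(\mathrm{am}\,u)$, $\mathrm{cn}\,u=\cos(\mathrm{am}\,u)$, $\mathrm{dn}\,u=\sqrt{1-k^2\,\mathrm{sn}^2u}$. The map $\psi_\alpha:T\to T$: for $z=e^{2i\theta}\in T$ ($\theta\in\mathbb R$), put $u=g(\theta)$, $a=g(\alpha)$, $\theta'=\mathrm{am}(u+a)$, and $\psi_\alpha(z)=e^{2i\theta'}$ (independent of the choice of $\theta$). For $0<a<K$, $C_a$ is the positively (counterclockwise) oriented circle with center $\left(\frac{\mathrm{dn}\,a-1}{\mathrm{dn}\,a+1},0\right)$ and radius $\frac{2\,\mathrm{cn}\,a}{1+\mathrm{dn}\,a}$; it lies inside $T$. A directed segment $z_1z_2$ (from $z_1$ to $z_2$, $z_1\ne z_2$) tangent to a positively oriented circle is on its right side if its direction agrees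 with the orientation of the circle at the point of tangency, equivalently if the center of the circle lies strictly to the left of the line directed from $z_1$ to $z_2$. *)

theory Defs
  imports "HOL-Analysis.Analysis"
begin

text \<open>
  All functions below take the modulus \<open>k\<close> as their first argument and are meant for
  \<open>0 < k < 1\<close>. The integral is oriented, so \<open>ell_g k\<close> is odd, and it is a bijection of
  the reals onto themselves.
\<close>

definition ell_g :: "real \<Rightarrow> real \<Rightarrow> real" where
  "ell_g k \<theta> = (LBINT t=ereal 0..ereal \<theta>. 1 / sqrt (1 - k\<^sup>2 * (sin t)\<^sup>2))"

definition am :: "real \<Rightarrow> real \<Rightarrow> real" where
  "am k = inv (ell_g k)"

definition sn :: "real \<Rightarrow> real \<Rightarrow> real" where
  "sn k u = sin (am k u)"

definition cn :: "real \<Rightarrow> real \<Rightarrow> real" where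
  "cn k u = cos (am k u)"

definition dn :: "real \<Rightarrow> real \<Rightarrow> real" where
  "dn k u = sqrt (1 - k\<^sup>2 * (sn k u)\<^sup>2)"

text \<open>
  \<open>psi k \<alpha> z\<close> is the common value of \<open>e\<^sup>2\<^sup>i\<^sup>\<theta>\<^sup>'\<close>, with \<open>\<theta>' = am (g \<theta> + g \<alpha>)\<close>, over all
  \<open>\<theta>\<close> with \<open>z = e\<^sup>2\<^sup>i\<^sup>\<theta>\<close>. It is meant for \<open>z\<close> on the unit circle only.
\<close>

definition psi :: "real \<Rightarrow> real \<Rightarrow> complex \<Rightarrow> complex" where
  "psi k \<alpha> z =
     (THE w. \<exists>\<theta>::real. z = cis (2 * \<theta>) \<and> w = cis (2 * am k (ell_g k \<theta> + ell_g k \<alpha>)))"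

definition circ_center :: "real \<Rightarrow> real \<Rightarrow> complex" where
  "circ_center k a = Complex ((dn k a - 1) / (dn k a + 1)) 0"

definition circ_radius :: "real \<Rightarrow> real \<Rightarrow> real" where
  "circ_radius k a = 2 * cn k a / (1 + dn k a)"

text \<open>
  A segment is tangent to a circle at \<open>p\<close> if its line meets the circle in \<open>p\<close> only and
  \<open>p\<close> belongs to the segment.
\<close>

definition segment_tangent_at ::
    "complex \<Rightarrow> complex \<Rightarrow> complex \<Rightarrow> real \<Rightarrow> complex \<Rightarrow> bool" where
  "segment_tangent_at z1 z2 c r p \<longleftrightarrow>
     z1 \<noteq> z2 \<and> p \<in> closed_segment z1 z2 \<and> affine hull {z1, z2} \<inter> sphere c r = {p}"

text \<open>
  The counterclockwise circle with center \<open>c\<close> has direction \<open>\<i> * (p - c)\<close> at its point \<open>p\<close>;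
  a tangent directed segment is on the right side if it has the same direction there.
\<close>

definition tangent_on_right_side :: "complex \<Rightarrow> complex \<Rightarrow> complex \<Rightarrow> real \<Rightarrow> bool" where
  "tangent_on_right_side z1 z2 c r \<longleftrightarrow>
     (\<exists>p. segment_tangent_at z1 z2 c r p \<and>
          (\<exists>t>0. z2 - z1 = complex_of_real t * (\<i> * (p - c))))"

end

theory Submission
  imports Defs
begin

text \<open>
  With \<open>\<sigma> = \<theta> + \<theta>'\<close> and \<open>\<delta> = \<theta>' - \<theta>\<close>, the chord from \<open>cis (2\<theta>)\<close> to \<open>cis (2\<theta>')\<close> lies on the
  line \<open>Re (w * cis (-\<sigma>)) = cos \<delta>\<close>, so that (for \<open>sin \<delta> > 0\<close>) it is tangent to the circle of
  center \<open>c\<close> and radius \<open>r\<close> on the right side iff \<open>c * cos \<sigma> + r = cos \<delta>\<close>. For the circle \<open>C\<^sub>a\<close> this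
  equation reads \<open>cn a = cn u * cn (u + a) + dn a * sn u * sn (u + a)\<close>, which is a consequence of the
  addition theorems for \<open>cn\<close> and \<open>dn\<close>. Conversely, a point of the unit circle has only one
  tangent of the required orientation, so its endpoint must be the one given by \<open>psi\<close>.
\<close>

section \<open>Jacobi elliptic functions\<close>

locale elliptic_modulus =
  fixes k :: real
  assumes k_pos: "0 < k" and k_less_1: "k < 1"
begin

section \<open>The elliptic integral and its inverse\<close>

lemma k_sq_less_1: "k\<^sup>2 < 1"
  using k_pos k_less_1 by (simp add: power_less_one_iff)

lemma radicand_pos: "0 < 1 - k\<^sup>2 * (sin t)\<^sup>2"
proof -
  have "k\<^sup>2 * (sin t)\<^sup>2 \<le> k\<^sup>2 * 1"
    by (intro mult_left_mono) (simp_all add: abs_square_le_1)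
  then show ?thesis using k_sq_less_1 by simp
qed

lemma ell_g_deriv:
  "(ell_g k has_field_derivative 1 / sqrt (1 - k\<^sup>2 * (sin x)\<^sup>2)) (at x)"
proof -
  let ?f = "\<lambda>t. 1 / sqrt (1 - k\<^sup>2 * (sin t)\<^sup>2)"
  have cont: "isCont ?f t" for t
    using radicand_pos[of t] by (intro continuous_intros) auto
  \<comment> \<open>A global antiderivative turns the oriented integral into
    \<open>F x - F 0\<close> for either sign of \<open>x\<close>.\<close>
  obtain F where F: "\<And>x. (F has_vector_derivative ?f x) (at x)"
    using einterval_antiderivative[of "-\<infinity>" "\<infinity>" ?f] cont by auto
  have "ell_g k x = F x - F 0" for x
    unfolding ell_g_def
    by (rule interval_integral_FTC_finite)
       (auto intro!: continuous_at_imp_continuous_on cont has_vector_derivative_at_within F)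
  then have "ell_g k = (\<lambda>x. F x - F 0)" by auto
  moreover have "((\<lambda>x. F x - F 0) has_field_derivative ?f x) (at x)"
    using F[of x] by (auto simp: has_real_derivative_iff_has_vector_derivative
        intro!: derivative_eq_intros)
  ultimately show ?thesis by simp
qed

lemma ell_g_0 [simp]: "ell_g k 0 = 0"
  by (simp add: ell_g_def)

lemma strict_mono_ell_g: "strict_mono (ell_g k)"
proof (rule strict_monoI)
  fix x y :: real assume "x < y"
  then show "ell_g k x < ell_g k y"
  proof (rule DERIV_pos_imp_increasing)
    fix t
    show "\<exists>y. (ell_g k has_real_derivative y) (at t) \<and> y > 0"
      using ell_g_deriv[of t] radicand_pos[of t] by (intro exI conjI) auto
  qed
qed

lemma isCont_ell_g: "isCont (ell_g k) x"
  using ell_g_deriv DERIV_isCont by blast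

text \<open>The integrand is at least 1. Hence the integral is unbounded in both directions, which
  yields surjectivity.\<close>

lemma ell_g_minus_id_mono: "x \<le> y \<Longrightarrow> ell_g k x - x \<le> ell_g k y - y"
proof (rule DERIV_nonneg_imp_nondecreasing[where f = "\<lambda>x. ell_g k x - x"])
  fix t
  have "1 - k\<^sup>2 * (sin t)\<^sup>2 \<le> 1" by simp
  then have "1 \<le> 1 / sqrt (1 - k\<^sup>2 * (sin t)\<^sup>2)"
    using radicand_pos[of t] by simp
  then show "\<exists>y. ((\<lambda>x. ell_g k x - x) has_real_derivative y) (at t) \<and> 0 \<le> y"
    by (intro exI[of _ "1 / sqrt (1 - k\<^sup>2 * (sin t)\<^sup>2) - 1"] conjI)
       (auto intro!: derivative_eq_intros ell_g_deriv)
qed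

lemma bij_ell_g: "bij (ell_g k)"
proof (rule bijI)
  show "inj (ell_g k)"
    using strict_mono_ell_g by (rule strict_mono_imp_inj_on)
  show "surj (ell_g k)"
    unfolding surj_def
  proof
    fix y :: real
    have "ell_g k (- \<bar>y\<bar>) \<le> y" "y \<le> ell_g k \<bar>y\<bar>"
      using ell_g_minus_id_mono[of "- \<bar>y\<bar>" 0] ell_g_minus_id_mono[of 0 "\<bar>y\<bar>"] by auto
    then show "\<exists>x. y = ell_g k x"
      using IVT[of "ell_g k" "- \<bar>y\<bar>" y "\<bar>y\<bar>"] isCont_ell_g by auto
  qed
qed

lemma am_ell_g [simp]: "am k (ell_g k x) = x"
  unfolding am_def using bij_ell_g by (simp add: bij_is_inj)

lemma ell_g_am [simp]: "ell_g k (am k u) = u"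
  unfolding am_def using bij_ell_g by (simp add: bij_is_surj surj_f_inv_f)

text \<open>The integrand has period \<open>pi\<close>, so the increment over a shift by
  \<open>pi\<close> has derivative zero.\<close>

lemma ell_g_add_pi: "ell_g k (x + pi) = ell_g k x + ell_g k pi"
proof -
  have "((\<lambda>x. ell_g k (x + pi) - ell_g k x) has_real_derivative 0) (at x)" for x
    by (auto intro!: derivative_eq_intros ell_g_deriv[THEN DERIV_chain2])
  then have "ell_g k (x + pi) - ell_g k x = ell_g k (0 + pi) - ell_g k 0"
    by (intro DERIV_isconst_all) auto
  then show ?thesis by simp
qed

lemma ell_g_add_nat_pi: "ell_g k (x + of_nat n * pi) = ell_g k x + of_nat n * ell_g k pi"
proof (induction n)
  case (Suc n)
  then show ?case
    using ell_g_add_pi[of "x + of_nat n * pi"] by (simp add: algebra_simps)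
qed simp

lemma ell_g_add_int_pi: "ell_g k (x + of_int n * pi) = ell_g k x + of_int n * ell_g k pi"
proof (cases n)
  case (nonneg m)
  then show ?thesis using ell_g_add_nat_pi[of x m] by simp
next
  case (neg m)
  define N where "N = Suc m"
  have "of_int n = - real N" unfolding neg N_def by simp
  \<comment> \<open>A negative shift is undone by a positive one that starts from the shifted
    point.\<close>
  then show ?thesis using ell_g_add_nat_pi[of "x + of_int n * pi" N] by simp
qed

lemma am_add_int_period: "am k (u + of_int n * ell_g k pi) = am k u + of_int n * pi"
  by (metis am_ell_g ell_g_am ell_g_add_int_pi)

lemma am_0 [simp]: "am k 0 = 0"
  by (metis am_ell_g ell_g_0)

lemma strict_mono_am: "strict_mono (am k)"
proof (rule strict_monoI)
  fix x y :: real assume "x < y"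
  then show "am k x < am k y"
    using strict_mono_less[OF strict_mono_ell_g, of "am k x" "am k y"] by simp
qed

section \<open>Derivatives of \<open>sn\<close>, \<open>cn\<close> and \<open>dn\<close>\<close>

lemma dn_eq: "dn k u = sqrt (1 - k\<^sup>2 * (sin (am k u))\<^sup>2)"
  by (simp add: dn_def sn_def)

lemma dn_pos: "dn k u > 0"
  unfolding dn_eq using radicand_pos by simp

lemma cn_sq: "(cn k u)\<^sup>2 = 1 - (sn k u)\<^sup>2"
  by (simp add: sn_def cn_def cos_squared_eq)

lemma dn_sq: "(dn k u)\<^sup>2 = 1 - k\<^sup>2 * (sn k u)\<^sup>2"
  using radicand_pos[of "am k u"] by (simp add: dn_def sn_def)

lemma sn_0 [simp]: "sn k 0 = 0" and cn_0 [simp]: "cn k 0 = 1" and dn_0 [simp]: "dn k 0 = 1"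
  by (simp_all add: sn_def cn_def dn_def)

lemma am_deriv: "(am k has_field_derivative dn k u) (at u)"
proof -
  have "isCont (am k) u"
    using isCont_inverse_function[of 1 "am k u" "am k" "ell_g k"] isCont_ell_g by simp
  moreover have "(ell_g k has_field_derivative 1 / dn k u) (at (am k u))"
    unfolding dn_eq by (rule ell_g_deriv)
  ultimately have "(am k has_field_derivative inverse (1 / dn k u)) (at u)"
    using dn_pos[of u] by (intro DERIV_inverse_function[of "ell_g k" _ _ _ "u - 1" "u + 1"]) auto
  then show ?thesis by simp
qed

lemma sn_deriv: "(sn k has_field_derivative cn k u * dn k u) (at u)"
  unfolding sn_def[abs_def] cn_def
  by (auto intro!: derivative_eq_intros am_deriv)

lemma cn_deriv: "(cn k has_field_derivative - (sn k u * dn k u)) (at u)"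
  unfolding cn_def[abs_def] sn_def
  by (auto intro!: derivative_eq_intros am_deriv)

lemma dn_deriv: "(dn k has_field_derivative - (k\<^sup>2 * sn k u * cn k u)) (at u)"
proof -
  have "((\<lambda>u. 1 - k\<^sup>2 * (sn k u)\<^sup>2) has_field_derivative
      - (2 * k\<^sup>2 * sn k u * cn k u * dn k u)) (at u)"
    by (auto intro!: derivative_eq_intros sn_deriv)
  moreover have "(sqrt has_field_derivative inverse (dn k u) / 2) (at (1 - k\<^sup>2 * (sn k u)\<^sup>2))"
    unfolding dn_def using radicand_pos by (intro DERIV_real_sqrt) (simp add: sn_def)
  ultimately have "((\<lambda>u. sqrt (1 - k\<^sup>2 * (sn k u)\<^sup>2)) has_field_derivative
      inverse (dn k u) / 2 * - (2 * k\<^sup>2 * sn k u * cn k u * dn k u)) (at u)"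
    by (rule DERIV_chain2[rotated])
  moreover have "dn k = (\<lambda>u. sqrt (1 - k\<^sup>2 * (sn k u)\<^sup>2))"
    by (simp add: fun_eq_iff dn_def)
  ultimately show ?thesis
    using dn_pos[of u] by (simp add: field_simps)
qed

text \<open>On the line \<open>u + v = w\<close> the second argument is \<open>w - x\<close>; these
  rules serve to differentiate the addition formulas along it.\<close>

lemma reflected_derivs:
  "((\<lambda>x. sn k (w - x)) has_field_derivative - (cn k (w - x) * dn k (w - x))) (at x)"
  "((\<lambda>x. cn k (w - x)) has_field_derivative sn k (w - x) * dn k (w - x)) (at x)"
  "((\<lambda>x. dn k (w - x)) has_field_derivative k\<^sup>2 * sn k (w - x) * cn k (w - x)) (at x)"
proof -
  have "((\<lambda>x. w - x) has_field_derivative - 1) (at x)"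
    by (auto intro!: derivative_eq_intros)
  note chain = DERIV_chain2[OF _ this]
  show "((\<lambda>x. sn k (w - x)) has_field_derivative - (cn k (w - x) * dn k (w - x))) (at x)"
    "((\<lambda>x. cn k (w - x)) has_field_derivative sn k (w - x) * dn k (w - x)) (at x)"
    "((\<lambda>x. dn k (w - x)) has_field_derivative k\<^sup>2 * sn k (w - x) * cn k (w - x)) (at x)"
    using chain[OF sn_deriv] chain[OF cn_deriv] chain[OF dn_deriv] by simp_all
qed

section \<open>Addition theorems\<close>

lemma addition_denominator_pos: "0 < 1 - k\<^sup>2 * (sn k u)\<^sup>2 * (sn k v)\<^sup>2"
proof -
  have "k\<^sup>2 * (sn k u)\<^sup>2 * (sn k v)\<^sup>2 \<le> k\<^sup>2 * 1 * 1"
    by (intro mult_mono) (simp_all add: sn_def abs_square_le_1)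
  then show ?thesis using k_sq_less_1 by simp
qed

text \<open>
  Both addition theorems hold because their right-hand sides have derivative zero along the lines
  \<open>u + v = const\<close>.
\<close>

lemma cn_add:
  "cn k (u + v) =
     (cn k u * cn k v - sn k u * sn k v * dn k u * dn k v) / (1 - k\<^sup>2 * (sn k u)\<^sup>2 * (sn k v)\<^sup>2)"
proof -
  define w where "w = u + v"
  define h where "h = (\<lambda>x. (cn k x * cn k (w - x) - sn k x * sn k (w - x) * dn k x * dn k (w - x))
     / (1 - k\<^sup>2 * (sn k x)\<^sup>2 * (sn k (w - x))\<^sup>2))"
  have "(h has_real_derivative 0) (at x)" for x
  proof -
    define s c d s' c' d' where "s = sn k x" and "c = cn k x" and "d = dn k x"
      and "s' = sn k (w - x)" and "c' = cn k (w - x)" and "d' = dn k (w - x)"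
    note defs = this
    \<comment> \<open>\<open>N\<close> and \<open>D\<close> are the numerator and denominator of
      \<open>h x\<close>; \<open>N'\<close> and \<open>D'\<close> are their derivatives, not yet
      simplified.\<close>
    define D where "D = 1 - k\<^sup>2 * s\<^sup>2 * s'\<^sup>2"
    define N where "N = c * c' - s * s' * d * d'"
    define D' where "D' = - 2 * k\<^sup>2 * s * s' * (c * d * s' - s * c' * d')"
    define N' where "N' = - s * d * c' + c * s' * d' - c * d * s' * d * d' + s * c' * d' * d * d'
      + s * s' * k\<^sup>2 * s * c * d' - s * s' * d * k\<^sup>2 * s' * c'"
    have "D \<noteq> 0"
      using addition_denominator_pos[of x "w - x"] by (simp add: D_def defs)
    have rel: "c\<^sup>2 = 1 - s\<^sup>2" "c'\<^sup>2 = 1 - s'\<^sup>2" "d\<^sup>2 = 1 - k\<^sup>2 * s\<^sup>2" "d'\<^sup>2 = 1 - k\<^sup>2 * s'\<^sup>2"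
      by (simp_all add: defs cn_sq dn_sq)
    \<comment> \<open>Two further forms of the denominator: with one substituted in each term,
      \<open>N' * D\<close> acquires the factor \<open>N\<close>.\<close>
    have D1: "D = c'\<^sup>2 + s'\<^sup>2 * d\<^sup>2" and D2: "D = c\<^sup>2 + s\<^sup>2 * d'\<^sup>2"
      unfolding D_def rel by (simp_all add: algebra_simps)
    have "N' = s * d * c' * (d'\<^sup>2 - 1 - k\<^sup>2 * s'\<^sup>2) + c * s' * d' * (1 - d\<^sup>2 + k\<^sup>2 * s\<^sup>2)"
      unfolding N'_def by algebra
    also have "\<dots> = 2 * k\<^sup>2 * s * s' * (s * c * d' - s' * c' * d)"
      unfolding rel(3,4) by algebra
    finally have N': "N' = \<dots>" .
    have "N' * D = 2 * k\<^sup>2 * s * s' * (s * c * d' * D - s' * c' * d * D)"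
      unfolding N' by algebra
    also have "\<dots> = 2 * k\<^sup>2 * s * s' *
        (s * c * d' * (c'\<^sup>2 + s'\<^sup>2 * d\<^sup>2) - s' * c' * d * (c\<^sup>2 + s\<^sup>2 * d'\<^sup>2))"
      by (simp only: D1[symmetric] D2[symmetric])
    also have "\<dots> = N * D'"
      unfolding N_def D'_def by algebra
    finally have "N' * D = N * D'" .
    moreover have "(h has_real_derivative (N' * D - N * D') / (D * D)) (at x)"
      unfolding h_def
      by (rule DERIV_cong, (rule sn_deriv cn_deriv dn_deriv reflected_derivs derivative_eq_intros refl)+)
         (use \<open>D \<noteq> 0\<close> in \<open>simp_all add: N_def D_def N'_def D'_def flip: defs,
           simp_all add: algebra_simps power2_eq_square\<close>)
    ultimately show ?thesis by simp
  qed
  \<comment> \<open>At \<open>0\<close> the quotient collapses to \<open>cn k w\<close>; at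
    \<open>u\<close> the reflected argument is \<open>v\<close>.\<close>
  then have "h u = h 0"
    by (intro DERIV_isconst_all) auto
  then show ?thesis by (simp add: h_def w_def)
qed

lemma dn_add:
  "dn k (u + v) =
     (dn k u * dn k v - k\<^sup>2 * sn k u * sn k v * cn k u * cn k v) / (1 - k\<^sup>2 * (sn k u)\<^sup>2 * (sn k v)\<^sup>2)"
proof -
  define w where "w = u + v"
  define h where "h = (\<lambda>x. (dn k x * dn k (w - x) - k\<^sup>2 * sn k x * sn k (w - x) * cn k x * cn k (w - x))
     / (1 - k\<^sup>2 * (sn k x)\<^sup>2 * (sn k (w - x))\<^sup>2))"
  have "(h has_real_derivative 0) (at x)" for x
  proof -
    define s c d s' c' d' where "s = sn k x" and "c = cn k x" and "d = dn k x"
      and "s' = sn k (w - x)" and "c' = cn k (w - x)" and "d' = dn k (w - x)"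
    note defs = this
    define D where "D = 1 - k\<^sup>2 * s\<^sup>2 * s'\<^sup>2"
    define N where "N = d * d' - k\<^sup>2 * s * s' * c * c'"
    define D' where "D' = - 2 * k\<^sup>2 * s * s' * (c * d * s' - s * c' * d')"
    define N' where "N' = k\<^sup>2 * (- s * c * d' + d * s' * c' - c * d * s' * c * c' + s * c' * d' * c * c'
      + s * s' * s * d * c' - s * s' * c * s' * d')"
    have "D \<noteq> 0"
      using addition_denominator_pos[of x "w - x"] by (simp add: D_def defs)
    have rel: "c\<^sup>2 = 1 - s\<^sup>2" "c'\<^sup>2 = 1 - s'\<^sup>2" "d\<^sup>2 = 1 - k\<^sup>2 * s\<^sup>2" "d'\<^sup>2 = 1 - k\<^sup>2 * s'\<^sup>2"
      by (simp_all add: defs cn_sq dn_sq)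
    \<comment> \<open>The same device as for \<open>cn\<close>, with the forms of \<open>D\<close>
      that now bring out the factor \<open>d * d' - k\<^sup>2 * s * s' * c * c'\<close>.\<close>
    have D1: "D = d'\<^sup>2 + k\<^sup>2 * s'\<^sup>2 * c\<^sup>2" and D2: "D = d\<^sup>2 + k\<^sup>2 * s\<^sup>2 * c'\<^sup>2"
      unfolding D_def rel by (simp_all add: algebra_simps)
    have "N' = k\<^sup>2 * (s * c * d' * (c'\<^sup>2 - 1 - s'\<^sup>2) + s' * c' * d * (1 - c\<^sup>2 + s\<^sup>2))"
      unfolding N'_def by algebra
    also have "\<dots> = 2 * k\<^sup>2 * s * s' * (s * c' * d - s' * c * d')"
      unfolding rel(1,2) by algebra
    finally have N': "N' = \<dots>" .
    have "N' * D = 2 * k\<^sup>2 * s * s' * (s * c' * d * D - s' * c * d' * D)"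
      unfolding N' by algebra
    also have "\<dots> = 2 * k\<^sup>2 * s * s' *
        (s * c' * d * (d'\<^sup>2 + k\<^sup>2 * s'\<^sup>2 * c\<^sup>2) - s' * c * d' * (d\<^sup>2 + k\<^sup>2 * s\<^sup>2 * c'\<^sup>2))"
      by (simp only: D1[symmetric] D2[symmetric])
    also have "\<dots> = N * D'"
      unfolding N_def D'_def by algebra
    finally have "N' * D = N * D'" .
    moreover have "(h has_real_derivative (N' * D - N * D') / (D * D)) (at x)"
      unfolding h_def
      by (rule DERIV_cong, (rule sn_deriv cn_deriv dn_deriv reflected_derivs derivative_eq_intros refl)+)
         (use \<open>D \<noteq> 0\<close> in \<open>simp_all add: N_def D_def N'_def D'_def flip: defs,
           simp_all add: algebra_simps power2_eq_square\<close>)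
    ultimately show ?thesis by simp
  qed
  then have "h u = h 0"
    by (intro DERIV_isconst_all) auto
  then show ?thesis by (simp add: h_def w_def)
qed

section \<open>Parity and the tangency relation\<close>

lemma ell_g_minus: "ell_g k (- x) = - ell_g k x"
proof -
  have "((\<lambda>x. ell_g k (- x) + ell_g k x) has_real_derivative 0) (at x)" for x
    by (auto intro!: derivative_eq_intros ell_g_deriv[THEN DERIV_chain2] ell_g_deriv)
  then have "ell_g k (- x) + ell_g k x = ell_g k (- 0) + ell_g k 0"
    by (intro DERIV_isconst_all) auto
  then show ?thesis by simp
qed

lemma am_minus: "am k (- u) = - am k u"
  by (metis am_ell_g ell_g_am ell_g_minus)

text \<open>Since \<open>a = - u + v\<close> with \<open>v = u + a\<close>, the addition theorems
  express \<open>cn k a\<close> and \<open>dn k a\<close> over one denominator in terms of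
  \<open>u\<close> and \<open>v\<close>.\<close>

lemma cn_diff_relation:
  "cn k u * cn k (u + a) + dn k a * sn k u * sn k (u + a) = cn k a"
proof -
  define v where "v = u + a"
  define D where "D = 1 - k\<^sup>2 * (sn k u)\<^sup>2 * (sn k v)\<^sup>2"
  have "D \<noteq> 0" using addition_denominator_pos[of u v] by (simp add: D_def)
  have minus: "sn k (- u) = - sn k u" "cn k (- u) = cn k u" "dn k (- u) = dn k u"
    by (simp_all add: sn_def cn_def dn_def am_minus)
  have "cn k a * D = cn k u * cn k v + sn k u * sn k v * dn k u * dn k v"
    using cn_add[of "- u" v] \<open>D \<noteq> 0\<close> by (simp add: v_def[symmetric] D_def[symmetric] minus)
       (simp add: v_def)
  moreover have "dn k a * D = dn k u * dn k v + k\<^sup>2 * sn k u * sn k v * cn k u * cn k v"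
    using dn_add[of "- u" v] \<open>D \<noteq> 0\<close> by (simp add: v_def[symmetric] D_def[symmetric] minus)
       (simp add: v_def)
  \<comment> \<open>The \<open>k\<^sup>2\<close> term of \<open>dn k a * D\<close> raises the
    coefficient of \<open>cn k u * cn k v\<close> from \<open>D\<close> to 1.\<close>
  ultimately have "(cn k u * cn k v + dn k a * sn k u * sn k v) * D = cn k a * D"
    unfolding D_def by algebra
  then show ?thesis using \<open>D \<noteq> 0\<close> by (simp add: v_def)
qed

text \<open>The choice of angle is immaterial: two choices differ by \<open>n * pi\<close>,
  \<open>ell_g\<close> turns this into \<open>n * ell_g k pi\<close>, and \<open>am\<close> turns it
  back into \<open>n * pi\<close>, which the doubled angle does not see.\<close>

lemma psi_cis: "psi k \<alpha> (cis (2 * \<theta>)) = cis (2 * am k (ell_g k \<theta> + ell_g k \<alpha>))"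
  unfolding psi_def
proof (rule the_equality)
  fix w
  assume "\<exists>\<theta>'. cis (2 * \<theta>) = cis (2 * \<theta>') \<and> w = cis (2 * am k (ell_g k \<theta>' + ell_g k \<alpha>))"
  then obtain \<theta>' where eq: "cis (2 * \<theta>) = cis (2 * \<theta>')"
    and w: "w = cis (2 * am k (ell_g k \<theta>' + ell_g k \<alpha>))" by blast
  have "sin (2 * \<theta>') = sin (2 * \<theta>) \<and> cos (2 * \<theta>') = cos (2 * \<theta>)"
    using eq by (simp add: complex_eq_iff)
  then obtain n :: int where "2 * \<theta>' = 2 * \<theta> + 2 * pi * n"
    using sin_cos_eq_iff by blast
  then have "2 * \<theta>' = 2 * (\<theta> + of_int n * pi)" by (simp add: algebra_simps)
  then have "\<theta>' = \<theta> + of_int n * pi" by simp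
  then have "am k (ell_g k \<theta>' + ell_g k \<alpha>) =
      am k (ell_g k \<theta> + ell_g k \<alpha> + of_int n * ell_g k pi)"
    by (simp only: ell_g_add_int_pi add_ac)
  also have "\<dots> = am k (ell_g k \<theta> + ell_g k \<alpha>) + of_int n * pi"
    by (rule am_add_int_period)
  finally have "2 * am k (ell_g k \<theta>' + ell_g k \<alpha>) =
      2 * am k (ell_g k \<theta> + ell_g k \<alpha>) + 2 * pi * of_int n" by simp
  then have "sin (2 * am k (ell_g k \<theta>' + ell_g k \<alpha>)) = sin (2 * am k (ell_g k \<theta> + ell_g k \<alpha>)) \<and>
      cos (2 * am k (ell_g k \<theta>' + ell_g k \<alpha>)) = cos (2 * am k (ell_g k \<theta> + ell_g k \<alpha>))"
    unfolding sin_cos_eq_iff by blast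
  then show "w = cis (2 * am k (ell_g k \<theta> + ell_g k \<alpha>))"
    unfolding w by (simp add: complex_eq_iff)
qed blast

end

section \<open>Tangent chords of the unit circle\<close>

lemma tangent_on_right_side_cis:
  fixes \<theta> \<theta>' c r :: real
  assumes sin_pos: "0 < sin (\<theta>' - \<theta>)" and "0 < r" and inside: "\<bar>c\<bar> + r \<le> 1"
    and eq: "c * cos (\<theta> + \<theta>') + r = cos (\<theta>' - \<theta>)"
  shows "tangent_on_right_side (cis (2 * \<theta>)) (cis (2 * \<theta>')) (complex_of_real c) r"
proof -
  define \<sigma> \<delta> where "\<sigma> = \<theta> + \<theta>'" and "\<delta> = \<theta>' - \<theta>"
  \<comment> \<open>After rotation by \<open>- \<sigma>\<close> the chord's line is vertical, and
    \<open>P y\<close> is its point at height \<open>y\<close>.\<close>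
  define P where "P y = cis \<sigma> * Complex (cos \<delta>) y" for y
  \<comment> \<open>The height of the rotated center, hence of the foot of the perpendicular from
    the center to the line.\<close>
  define y0 where "y0 = - c * sin \<sigma>"
  define p where "p = complex_of_real c + of_real r * cis \<sigma>"
  have z: "cis (2 * \<theta>) = P (- sin \<delta>)" "cis (2 * \<theta>') = P (sin \<delta>)"
  proof -
    have "P (- sin \<delta>) = cis (\<sigma> - \<delta>)" "P (sin \<delta>) = cis (\<sigma> + \<delta>)"
      by (simp_all add: P_def complex_eq_iff sin_diff cos_diff sin_add cos_add algebra_simps)
    then show "cis (2 * \<theta>) = P (- sin \<delta>)" "cis (2 * \<theta>') = P (sin \<delta>)"
      by (simp_all add: \<sigma>_def \<delta>_def)
  qed
  have eq': "cos \<delta> = c * cos \<sigma> + r" using eq by (simp add: \<sigma>_def \<delta>_def)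
  have p: "p = P y0"
    using sin_cos_squared_add[of \<sigma>]
    unfolding p_def P_def y0_def complex_eq_iff eq' by (simp; algebra)
  \<comment> \<open>The circle lies in the closed unit disc, so the foot \<open>p\<close> does too;
    this is what puts it between the endpoints of the chord.\<close>
  have norm_p: "cmod p \<le> 1"
  proof -
    have "cmod p \<le> \<bar>c\<bar> + r"
      unfolding p_def using norm_triangle_ineq[of "of_real c" "of_real r * cis \<sigma>"] \<open>0 < r\<close>
      by (simp add: norm_mult)
    then show ?thesis using inside by simp
  qed
  have comb: "(1 - t) *\<^sub>R P x + t *\<^sub>R P y = P ((1 - t) * x + t * y)" for t x y
    by (simp add: P_def complex_eq_iff algebra_simps)
  have "(cmod p)\<^sup>2 = (cos \<delta>)\<^sup>2 + y0\<^sup>2"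
    unfolding p P_def by (simp add: norm_mult cmod_power2)
  moreover have "(cmod p)\<^sup>2 \<le> 1" using norm_p by (simp add: power_le_one)
  ultimately have "y0\<^sup>2 \<le> (sin \<delta>)\<^sup>2" by (simp add: sin_squared_eq)
  then have y0: "\<bar>y0\<bar> \<le> sin \<delta>"
    using sin_pos by (simp add: \<delta>_def abs_le_square_iff[symmetric])
  have seg: "p \<in> closed_segment (cis (2 * \<theta>)) (cis (2 * \<theta>'))"
    unfolding z p in_segment comb using y0 sin_pos
    \<comment> \<open>The witness solves
      \<open>(1 - t) * (- sin \<delta>) + t * sin \<delta> = y0\<close>.\<close>
    by (intro exI[of _ "(y0 + sin \<delta>) / (2 * sin \<delta>)"])
       (auto simp: \<delta>_def[symmetric] field_simps)
  have on_circle: "P y \<in> sphere (of_real c) r \<longleftrightarrow> y = y0" for y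
  proof -
    \<comment> \<open>Pythagoras: the line is at distance \<open>r\<close> from the center, so only
      the foot is on the circle.\<close>
    have "(cmod (P y - of_real c))\<^sup>2 = r\<^sup>2 + (y - y0)\<^sup>2"
      using sin_cos_squared_add[of \<sigma>]
      unfolding P_def y0_def cmod_power2 eq' by (simp; algebra)
    moreover have "P y \<in> sphere (of_real c) r \<longleftrightarrow> (cmod (P y - of_real c))\<^sup>2 = r\<^sup>2"
      using \<open>0 < r\<close> by (simp add: dist_norm norm_minus_commute)
    ultimately show ?thesis by simp
  qed
  have line: "\<exists>y. w = P y" if "w \<in> affine hull {cis (2 * \<theta>), cis (2 * \<theta>')}" for w
  proof -
    obtain u v where "u + v = 1" and w: "w = u *\<^sub>R P (- sin \<delta>) + v *\<^sub>R P (sin \<delta>)"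
      using \<open>w \<in> affine hull _\<close> unfolding affine_hull_2 z by blast
    then have "u = 1 - v" by simp
    then show ?thesis using w comb by blast
  qed
  have "p \<in> affine hull {cis (2 * \<theta>), cis (2 * \<theta>')}"
    using seg convex_hull_subset_affine_hull by (auto simp: segment_convex_hull)
  moreover have "p \<in> sphere (of_real c) r"
    unfolding p on_circle by simp
  moreover have "w = p" if hull: "w \<in> affine hull {cis (2 * \<theta>), cis (2 * \<theta>')}"
    and circle: "w \<in> sphere (of_real c) r" for w
  proof -
    obtain y where "w = P y" using line[OF hull] by blast
    then show "w = p" using circle on_circle[of y] unfolding p by simp
  qed
  ultimately have "affine hull {cis (2 * \<theta>), cis (2 * \<theta>')} \<inter> sphere (of_real c) r = {p}"
    by blast
  moreover have diff: "cis (2 * \<theta>') - cis (2 * \<theta>) =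
      of_real (2 * sin \<delta> / r) * (\<i> * (p - of_real c))"
    unfolding z P_def p_def using \<open>0 < r\<close> by (simp add: complex_eq_iff)
  moreover have "cis (2 * \<theta>) \<noteq> cis (2 * \<theta>')"
  proof
    assume "cis (2 * \<theta>) = cis (2 * \<theta>')"
    then show False using diff sin_pos \<open>0 < r\<close> by (simp add: p_def \<delta>_def)
  qed
  ultimately show ?thesis
    unfolding tangent_on_right_side_def segment_tangent_at_def
    using seg sin_pos \<open>0 < r\<close> by (intro exI[of _ p] conjI exI[of _ "2 * sin \<delta> / r"])
      (auto simp: \<delta>_def)
qed

text \<open>The distance from \<open>z1\<close> to the center fixes the tangent length, the
  orientation then fixes the point of tangency, and the tangent line meets the unit circle in at
  most one further point.\<close>

lemma tangent_on_right_side_unique: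
  assumes "0 < r" and "cmod z1 = 1" and "cmod z2 = 1" and "cmod z3 = 1"
    and "tangent_on_right_side z1 z2 c r" and "tangent_on_right_side z1 z3 c r"
  shows "z2 = z3"
proof -
  \<comment> \<open>Here \<open>q\<close> is the radius vector to the point of tangency;
    \<open>t\<close> and \<open>\<tau>\<close> measure, in multiples of \<open>\<i> * q\<close>, the
    whole chord and its part from \<open>z1\<close> to that point.\<close>
  have tangent_data: "\<exists>q t \<tau>. z = z1 + of_real t * (\<i> * q) \<and> 0 < t \<and> 0 \<le> \<tau> \<and>
      z1 - c = q * (1 - \<i> * of_real \<tau>) \<and> cmod q = r \<and> t * r\<^sup>2 = - 2 * Re (cnj z1 * (\<i> * q))"
    if tan: "tangent_on_right_side z1 z c r" and "cmod z = 1" for z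
  proof -
    obtain p t where seg: "segment_tangent_at z1 z c r p" and "0 < t"
      and diff: "z - z1 = of_real t * (\<i> * (p - c))"
      using tan unfolding tangent_on_right_side_def by blast
    obtain l where "0 \<le> l" and l: "p = (1 - l) *\<^sub>R z1 + l *\<^sub>R z"
      using seg unfolding segment_tangent_at_def in_segment by blast
    have "p \<in> sphere c r" using seg unfolding segment_tangent_at_def by blast
    then have norm: "cmod (p - c) = r" by (simp add: dist_norm norm_minus_commute)
    have z: "z = z1 + of_real t * (\<i> * (p - c))" using diff by (simp add: algebra_simps)
    have "p - z1 = of_real l * (z - z1)" unfolding l by (simp add: scaleR_conv_of_real algebra_simps)
    then have "z1 - c = (p - c) * (1 - \<i> * of_real (l * t))"
      unfolding diff by (simp add: algebra_simps)
    moreover have "t * r\<^sup>2 = - 2 * Re (cnj z1 * (\<i> * (p - c)))"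
    proof -
      define q where "q = \<i> * (p - c)"
      have "(cmod z)\<^sup>2 = (cmod z1)\<^sup>2 + 2 * t * Re (cnj z1 * q) + t\<^sup>2 * (cmod q)\<^sup>2"
        unfolding z q_def[symmetric] by (simp add: cmod_power2; algebra)
      moreover have "cmod q = r" using norm by (simp add: q_def norm_mult)
      \<comment> \<open>Both endpoints have modulus 1; the root \<open>t = 0\<close> is
        \<open>z1\<close> itself, and \<open>t > 0\<close> selects the other one.\<close>
      ultimately have "t * (t * r\<^sup>2 + 2 * Re (cnj z1 * q)) = 0"
        using \<open>cmod z = 1\<close> \<open>cmod z1 = 1\<close> by (simp add: algebra_simps power2_eq_square)
      then have "t * r\<^sup>2 + 2 * Re (cnj z1 * q) = 0" using \<open>0 < t\<close> by (simp only: mult_eq_0_iff) auto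
      then show ?thesis by (simp only: q_def)
    qed
    ultimately show ?thesis using \<open>0 < t\<close> \<open>0 \<le> l\<close> norm z
      by (intro exI[of _ "p - c"] exI[of _ t] exI[of _ "l * t"]) auto
  qed
  obtain q t \<tau> where z2: "z2 = z1 + of_real t * (\<i> * q)" and "0 \<le> \<tau>"
    and q: "z1 - c = q * (1 - \<i> * of_real \<tau>)" "cmod q = r"
    and t: "t * r\<^sup>2 = - 2 * Re (cnj z1 * (\<i> * q))"
    using tangent_data[OF assms(5,3)] by blast
  obtain q' t' \<tau>' where z3: "z3 = z1 + of_real t' * (\<i> * q')" and "0 \<le> \<tau>'"
    and q': "z1 - c = q' * (1 - \<i> * of_real \<tau>')" "cmod q' = r"
    and t': "t' * r\<^sup>2 = - 2 * Re (cnj z1 * (\<i> * q'))"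
    using tangent_data[OF assms(6,4)] by blast
  have pow: "(cmod (1 - \<i> * of_real x))\<^sup>2 = 1 + x\<^sup>2" for x
    by (simp add: cmod_power2)
  have "(cmod (z1 - c))\<^sup>2 = r\<^sup>2 * (1 + \<tau>\<^sup>2)"
    by (simp only: q norm_mult power_mult_distrib pow)
  moreover have "(cmod (z1 - c))\<^sup>2 = r\<^sup>2 * (1 + \<tau>'\<^sup>2)"
    by (simp only: q' norm_mult power_mult_distrib pow)
  ultimately have "\<tau>\<^sup>2 = \<tau>'\<^sup>2" using \<open>0 < r\<close> by simp
  \<comment> \<open>The sign condition says that the point of tangency is not behind
    \<open>z1\<close>, which excludes the other tangent through \<open>z1\<close>.\<close>
  then have "\<tau> = \<tau>'" using \<open>0 \<le> \<tau>\<close> \<open>0 \<le> \<tau>'\<close> by simp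
  moreover have "1 - \<i> * of_real \<tau> \<noteq> 0" by (simp add: complex_eq_iff)
  ultimately have "q = q'" using q(1) q'(1) by simp
  then have "t = t'" using t t' \<open>0 < r\<close> by (metis mult_right_cancel power_not_zero less_irrefl)
  then show ?thesis using z2 z3 \<open>q = q'\<close> by simp
qed

section \<open>Chords cut out by \<open>psi\<close>, and the converse\<close>

theorem theorem5:
  fixes k \<alpha> a :: real
  assumes "0 < k" and "k < 1"
    and "0 < \<alpha>" and "\<alpha> < pi / 2"
    and "a = ell_g k \<alpha>"
  shows "(\<forall>z1 z2 :: complex.
            z1 \<in> sphere 0 1 \<and> z2 = psi k \<alpha> z1 \<longrightarrow>
            tangent_on_right_side z1 z2 (circ_center k a) (circ_radius k a)) \<and>
         (\<forall>z1 z2 :: complex.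
            z1 \<in> sphere 0 1 \<and> z2 \<in> sphere 0 1 \<and>
            tangent_on_right_side z1 z2 (circ_center k a) (circ_radius k a) \<longrightarrow>
            z2 = psi k \<alpha> z1)"
proof -
  interpret elliptic_modulus k using assms by unfold_locales
  have am_a: "am k a = \<alpha>" using assms by simp
  define d where "d = dn k a"
  define c where "c = cn k a"
  have "0 < d" unfolding d_def by (rule dn_pos)
  have c_pos: "0 < c" using assms by (simp add: c_def cn_def am_a cos_gt_zero)
  \<comment> \<open>The circle lies in the closed unit disc exactly when
    \<open>1 - d + 2 * c \<le> d + 1\<close>, that is, when \<open>c \<le> d\<close>.\<close>
  have "c\<^sup>2 \<le> d\<^sup>2"
  proof -
    have "k\<^sup>2 * (sn k a)\<^sup>2 \<le> 1 * (sn k a)\<^sup>2"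
      using k_sq_less_1 by (intro mult_right_mono) auto
    then show ?thesis using cn_sq[of a] dn_sq[of a] by (simp add: c_def d_def)
  qed
  then have "c \<le> d" using \<open>0 < d\<close> by (intro power2_le_imp_le[of c d]) auto
  have "d\<^sup>2 \<le> 1" using dn_sq[of a] by (simp add: d_def)
  then have "d \<le> 1" by (intro power2_le_imp_le[of d 1]) auto
  have radius_pos: "0 < circ_radius k a"
    using c_pos \<open>0 < d\<close> by (simp add: circ_radius_def c_def d_def)
  have inside: "\<bar>(d - 1) / (d + 1)\<bar> + circ_radius k a \<le> 1"
  proof -
    have "\<bar>(d - 1) / (d + 1)\<bar> = (1 - d) / (d + 1)"
      using \<open>0 < d\<close> \<open>d \<le> 1\<close> by (simp add: abs_if field_simps)
    then have "\<bar>(d - 1) / (d + 1)\<bar> + circ_radius k a = (1 - d + 2 * c) / (d + 1)"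
      by (simp only: circ_radius_def c_def d_def add_divide_distrib add.commute[of 1 "dn k a"])
    also have "\<dots> \<le> 1" using \<open>c \<le> d\<close> \<open>0 < d\<close> by simp
    finally show ?thesis .
  qed
  have center: "circ_center k a = of_real ((d - 1) / (d + 1))"
    by (simp add: circ_center_def d_def complex_eq_iff)
  have forward: "tangent_on_right_side z (psi k \<alpha> z) (circ_center k a) (circ_radius k a) \<and>
      cmod (psi k \<alpha> z) = 1" if "cmod z = 1" for z
  proof -
    define \<theta> where "\<theta> = Arg z / 2"
    define \<theta>' where "\<theta>' = am k (ell_g k \<theta> + a)"
    have z: "z = cis (2 * \<theta>)"
      using cis_Arg[of z] that by (force simp: \<theta>_def sgn_eq)
    have psi: "psi k \<alpha> z = cis (2 * \<theta>')"
      unfolding z psi_cis \<theta>'_def using assms by simp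
    \<comment> \<open>These bounds place \<open>\<theta>'\<close> strictly between
      \<open>\<theta>\<close> and \<open>\<theta> + pi\<close>, so the sine of the difference is
      positive.\<close>
    have "0 < a" "a < ell_g k pi"
      using strict_mono_less[OF strict_mono_ell_g] assms
      by (metis ell_g_0, simp)
    then have "am k (ell_g k \<theta>) < \<theta>'" "\<theta>' < am k (ell_g k (\<theta> + pi))"
      unfolding \<theta>'_def ell_g_add_pi strict_mono_less[OF strict_mono_am] by simp_all
    then have "0 < sin (\<theta>' - \<theta>)" by (intro sin_gt_zero) auto
    moreover have "(d - 1) / (d + 1) * cos (\<theta> + \<theta>') + circ_radius k a = cos (\<theta>' - \<theta>)"
    proof -
      have "cos \<theta> * cos \<theta>' + d * sin \<theta> * sin \<theta>' = c"
        using cn_diff_relation[of "ell_g k \<theta>" a]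
        by (simp add: cn_def[of k "ell_g k _"] cn_def[of k "_ + _"] sn_def \<theta>'_def d_def c_def)
      \<comment> \<open>The products of cosines and of sines are half the sum and half the
        difference of \<open>cos (\<theta>' - \<theta>)\<close> and
        \<open>cos (\<theta> + \<theta>')\<close>.\<close>
      then have "(d - 1) * cos (\<theta> + \<theta>') + 2 * c = (d + 1) * cos (\<theta>' - \<theta>)"
        unfolding cos_add cos_diff by (simp add: algebra_simps)
      moreover have "(d - 1) / (d + 1) * cos (\<theta> + \<theta>') + circ_radius k a =
          ((d - 1) * cos (\<theta> + \<theta>') + 2 * c) / (d + 1)"
        by (simp add: circ_radius_def c_def d_def add_divide_distrib add.commute[of 1 "dn k a"])
      ultimately show ?thesis using \<open>0 < d\<close> by simp
    qed
    ultimately have "tangent_on_right_side (cis (2 * \<theta>)) (cis (2 * \<theta>'))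
        (of_real ((d - 1) / (d + 1))) (circ_radius k a)"
      by (intro tangent_on_right_side_cis radius_pos inside)
    then show ?thesis
      unfolding psi center z[symmetric] by simp
  qed
  \<comment> \<open>For the converse, \<open>psi k \<alpha> z1\<close> is by \<open>forward\<close>
    also the end of such a tangent chord from \<open>z1\<close>, so uniqueness identifies it with
    \<open>z2\<close>.\<close>
  show ?thesis
    using forward tangent_on_right_side_unique[OF radius_pos]
    by (auto simp: dist_norm)
qed

end
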